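(* $$\int_0^1 \ln(-\ln x)\,\frac{1}{1+x+x^2}\,dx = \frac{\pi}{\sqrt3}\,\ln\frac{\sqrt[3]{2\pi}\,\Gamma\left(\frac23\right)}{\Gamma\left(\frac13\right)}.$$
   Context: $\Gamma$ denotes the gamma function. *)

theory Defs
  imports "HOL-Analysis.Analysis"
begin

end

theory Submission
  imports Defs "HOL-Complex_Analysis.Complex_Analysis" "HOL-Real_Asymp.Real_Asymp"
begin

text \<open>
  Substituting \<open>x = exp (- t)\<close> turns the integral into half of \<open>F 0\<close>, where \<open>F a\<close> is the integral of
  \<open>ln (t\<^sup>2 + a\<^sup>2) / 2 / (exp t + 1 + exp (- t))\<close> over the real line. The kernel has period \<open>2 \<pi> \<i>\<close> and
  \<open>ln (t\<^sup>2 + a\<^sup>2) / 2\<close> is the real part of \<open>Ln (a - \<i> t)\<close>, so shifting the contour by \<open>2 \<pi> \<i>\<close> replaces \<open>a\<close>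
  by \<open>a + 2 \<pi>\<close> and picks up the residues at \<open>2 \<pi> \<i> / 3\<close> and \<open>4 \<pi> \<i> / 3\<close>:
  \<open>F (a + 2 \<pi>) - F a = 2 \<pi> / sqrt 3 * ln ((a + 4 \<pi> / 3) / (a + 2 \<pi> / 3))\<close>.
  Iterating from \<open>a = 0\<close> expresses \<open>F (2 \<pi> n) - F 0\<close> through Pochhammer symbols. As \<open>n\<close> tends to infinity,
  \<open>F (2 \<pi> n)\<close> behaves like \<open>2 \<pi> / (3 sqrt 3) * ln (2 \<pi> n)\<close>, and Euler's limit for the Gamma function
  yields \<open>F 0\<close>.
\<close>

section \<open>The kernel, its total mass and its first moment\<close>

definition kern :: "real \<Rightarrow> real" where
  "kern t = 1 / (exp t + 1 + exp (- t))"

text \<open>This is \<open>F\<close> of the overview. At \<open>a = 0\<close> the logarithmic factor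
  is \<open>ln \<bar>t\<bar>\<close>, so the integral sought and all its shifts are values of one
  function.\<close>

definition logint :: "real \<Rightarrow> real" where
  "logint a = (LBINT t. ln (t\<^sup>2 + a\<^sup>2) / 2 * kern t)"

lemma kern_denom_pos: "exp t + 1 + exp (- t) > (0::real)"
  by (simp add: add_pos_pos)

lemma kern_pos: "kern t > 0" and kern_le_1: "kern t \<le> 1" and kern_minus [simp]: "kern (- t) = kern t"
proof -
  show "kern t > 0"
    using kern_denom_pos[of t] by (simp add: kern_def)
  have "1 \<le> exp t + 1 + exp (- t)"
    using exp_gt_zero[of t] exp_gt_zero[of "-t"] by linarith
  thus "kern t \<le> 1"
    using kern_denom_pos[of t] by (simp add: kern_def divide_le_eq_1)
  show "kern (- t) = kern t"
    by (simp add: kern_def add_ac)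
qed

lemma borel_measurable_kern [measurable]: "kern \<in> borel_measurable borel"
  unfolding kern_def [abs_def] by measurable

text \<open>The substitution \<open>u = exp t\<close> turns \<open>kern t dt\<close> into
  \<open>du / (u^2 + u + 1)\<close>, whose antiderivative is an arctangent. It runs from
  \<open>pi / 6\<close> at \<open>u = 0\<close> to \<open>pi / 2\<close> at infinity, and positivity
  of the kernel lets the fundamental theorem give integrability as well.\<close>

lemma
  shows integrable_kern: "integrable lborel kern"
    and integral_kern: "(LBINT t. kern t) = 2 * pi / (3 * sqrt 3)"
proof -
  define F where "F = (\<lambda>t. 2 / sqrt 3 * arctan ((2 * exp t + 1) / sqrt 3))"
  have dF: "(F has_field_derivative kern t) (at t)" for t
  proof -
    have "((\<lambda>t. (2 * exp t + 1) / sqrt 3) has_field_derivative 2 * exp t / sqrt 3) (at t)"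
      by (intro DERIV_cdivide) (auto intro!: derivative_eq_intros)
    hence "(F has_field_derivative
            2 / sqrt 3 * (inverse (1 + ((2 * exp t + 1) / sqrt 3)\<^sup>2) * (2 * exp t / sqrt 3))) (at t)"
      unfolding F_def by (intro DERIV_cmult DERIV_chain2[OF DERIV_arctan])
    also have "2 / s * (inverse X * (2 * e / s)) = 4 * e / (s * s) / X" for s e X :: real
      by (simp add: field_simps)
    also have "4 * exp t / (sqrt 3 * sqrt 3) / (1 + ((2 * exp t + 1) / sqrt 3)\<^sup>2) =
               4 * exp t / (sqrt 3 * sqrt 3) / (1 + (2 * exp t + 1)\<^sup>2 / 3)"
      by (simp only: power_divide) simp
    also have "\<dots> = 4 * exp t / (3 + (2 * exp t + 1)\<^sup>2)"
      by (simp add: divide_simps)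
    also have "\<dots> = kern t"
    proof -
      have "exp t * exp (- t) = 1"
        by (simp flip: exp_add)
      moreover have "exp t + 1 + exp (- t) \<noteq> 0" "3 + (2 * exp t + 1)\<^sup>2 \<noteq> 0"
        using kern_denom_pos[of t] by (auto simp: add_nonneg_eq_0_iff)
      ultimately show ?thesis
        unfolding kern_def by (simp add: frac_eq_eq power2_eq_square algebra_simps)
    qed
    finally show ?thesis .
  qed
  have cont: "isCont kern t" for t
    using kern_denom_pos[of t] unfolding kern_def [abs_def] by (intro continuous_intros) auto
  have a1: "arctan (1 / sqrt 3) = pi / 6"
    using tan_30 by (intro arctan_unique) auto
  have lim1: "(F \<longlongrightarrow> 2 / sqrt 3 * arctan ((2 * 0 + 1) / sqrt 3)) at_bot"
    unfolding F_def by (intro tendsto_intros exp_at_bot) auto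
  have "filterlim (\<lambda>t. (2 * exp t + 1) / sqrt 3) at_top at_top"
    by real_asymp
  hence lim2: "(F \<longlongrightarrow> 2 / sqrt 3 * (pi / 2)) at_top"
    unfolding F_def
    by (intro tendsto_intros filterlim_compose[OF tendsto_arctan_at_top])
  have *: "set_integrable lborel (einterval (-\<infinity>) \<infinity>) kern"
          "(LBINT x=-\<infinity>..\<infinity>. kern x) = 2 / sqrt 3 * (pi / 2) - 2 / sqrt 3 * arctan ((2 * 0 + 1) / sqrt 3)"
    using interval_integral_FTC_nonneg[of "-\<infinity>" "\<infinity>" F kern, OF _ dF cont] lim1 lim2 kern_pos
    by (auto simp: ereal_tendsto_simps less_imp_le)
  show "integrable lborel kern"
    using * by (simp add: set_integrable_def)
  show "(LBINT t. kern t) = 2 * pi / (3 * sqrt 3)"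
    using * a1 by (simp add: interval_lebesgue_integral_def set_lebesgue_integral_def field_simps)
qed

text \<open>With \<open>u = exp (t/2) + exp (-t/2)\<close> the denominator of the kernel is \<open>(u - 1) (u + 1)\<close>.\<close>
lemma abs_mult_kern_le: "\<bar>t\<bar> * kern t \<le> 2 * kern (t / 2)"
proof -
  define u where "u = exp (t / 2) + exp (- t / 2)"
  have "exp (\<bar>t\<bar> / 2) \<le> u - exp (- \<bar>t\<bar> / 2)"
    by (cases "t \<ge> 0") (auto simp: u_def)
  hence "1 + \<bar>t\<bar> / 2 < u"
    using exp_ge_add_one_self[of "\<bar>t\<bar> / 2"] exp_gt_zero[of "- \<bar>t\<bar> / 2"] by linarith
  hence u: "\<bar>t\<bar> < 2 * (u - 1)" "u > 1"
    by auto
  have "exp t + 1 + exp (- t) = (u - 1) * (u + 1)"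
    by (simp add: u_def algebra_simps flip: exp_add)
  hence "\<bar>t\<bar> * kern t = \<bar>t\<bar> / ((u - 1) * (u + 1))"
    by (simp add: kern_def)
  also have "\<dots> \<le> (2 * (u - 1)) / ((u - 1) * (u + 1))"
    using u by (intro divide_right_mono) auto
  also have "\<dots> = 2 * kern (t / 2)"
  proof -
    have "(2 * (u - 1)) / ((u - 1) * (u + 1)) = 2 / (u + 1)"
      using u nonzero_mult_divide_mult_cancel_left[of "u - 1" 2 "u + 1"] by (simp add: mult.commute)
    thus ?thesis
      by (simp add: kern_def u_def add_ac)
  qed
  finally show ?thesis .
qed

lemma integrable_abs_mult_kern: "integrable lborel (\<lambda>t. \<bar>t\<bar> * kern t)"
proof (rule Bochner_Integration.integrable_bound)
  show "integrable lborel (\<lambda>t. 2 * kern (t / 2))"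
    using lborel_integrable_real_affine[OF integrable_kern, of "1/2" 0] by simp
  show "AE t in lborel. norm (\<bar>t\<bar> * kern t) \<le> norm (2 * kern (t / 2))"
    using abs_mult_kern_le kern_pos by (simp add: abs_mult less_imp_le)
qed auto

section \<open>An integrable majorant for the logarithmic integrand\<close>

text \<open>The negative part of \<open>ln \<bar>t\<bar>\<close>, which isolates the singularity at
  the origin.\<close>

definition neglog :: "real \<Rightarrow> real" where
  "neglog t = - ln \<bar>t\<bar> * indicator {-1<..<1} t"

lemma neglog_nonneg: "neglog t \<ge> 0"
  by (cases "t = 0") (auto simp: neglog_def indicator_def)

lemma borel_measurable_neglog [measurable]: "neglog \<in> borel_measurable borel"
  unfolding neglog_def [abs_def] by measurable

lemma integrable_neglog: "integrable lborel neglog"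
proof -
  define F where "F = (\<lambda>t::real. t - t * ln t)"
  have lim1: "(F \<longlongrightarrow> 0) (at_right 0)" "(F \<longlongrightarrow> 1) (at_left 1)"
    unfolding F_def by real_asymp+
  have "set_integrable lborel (einterval (ereal 0) (ereal 1)) (\<lambda>t. - ln t)"
    by (rule interval_integral_FTC_nonneg(1)[of _ _ F _ 0 1])
       (use lim1 in \<open>auto intro!: derivative_eq_intros continuous_intros simp: ereal_tendsto_simps F_def zero_ereal_def one_ereal_def\<close>)
  hence *: "integrable lborel (\<lambda>t::real. - ln t * indicator {0<..<1} t)"
    by (simp add: set_integrable_def mult.commute)
  have **: "integrable lborel (\<lambda>t::real. - ln (-t) * indicator {0<..<1} (-t))"
    using lborel_integrable_real_affine[OF *, of "-1" 0] by simp
  \<comment> \<open>The two halves omit the origin; equality holds there too because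
    \<open>ln 0 = 0\<close>.\<close>
  have "neglog = (\<lambda>t. - ln t * indicator {0<..<1} t + (- ln (-t) * indicator {0<..<1} (-t)))"
    by (auto simp: neglog_def indicator_def fun_eq_iff)
  thus ?thesis
    using Bochner_Integration.integrable_add[OF * **] by simp
qed

text \<open>A majorant uniform in \<open>0 \<le> a \<le> M\<close>: the first summand controls the
  growth at infinity, the second the singularity at \<open>0\<close>.\<close>

definition log_kern_dom :: "real \<Rightarrow> real \<Rightarrow> real" where
  "log_kern_dom M t = (M + \<bar>t\<bar>) * kern t + neglog t"

lemma integrable_log_kern_dom: "integrable lborel (log_kern_dom M)"
  unfolding log_kern_dom_def [abs_def] distrib_right
  by (intro Bochner_Integration.integrable_add integrable_neglog integrable_abs_mult_kern
            integrable_mult_right integrable_kern)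

text \<open>From above, \<open>t^2 + a^2 \<le> (\<bar>t\<bar> + M)^2\<close> and
  \<open>ln x \<le> x\<close>; from below, dropping \<open>a^2\<close> leaves
  \<open>ln \<bar>t\<bar>\<close>, whatever \<open>a\<close> is. The point \<open>t = 0\<close> must
  be excluded: there \<open>neglog\<close> is \<open>0\<close>, while \<open>ln (a^2)\<close> can be
  very negative.\<close>

lemma log_kern_bound:
  assumes "0 \<le> a" "a \<le> M" "t \<noteq> 0"
  shows   "\<bar>ln (t\<^sup>2 + a\<^sup>2) / 2 * kern t\<bar> \<le> log_kern_dom M t"
proof -
  have "ln (t\<^sup>2 + a\<^sup>2) \<le> ln ((\<bar>t\<bar> + M)\<^sup>2)"
  proof (rule ln_mono)
    have "t\<^sup>2 + a\<^sup>2 \<le> t\<^sup>2 + M\<^sup>2"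
      using assms by (simp add: power_mono)
    also have "\<dots> \<le> (\<bar>t\<bar> + M)\<^sup>2"
      using assms by (simp add: power2_sum)
    finally show "t\<^sup>2 + a\<^sup>2 \<le> (\<bar>t\<bar> + M)\<^sup>2" .
  qed (use assms in \<open>auto simp: sum_power2_gt_zero_iff\<close>)
  also have "\<dots> = 2 * ln (\<bar>t\<bar> + M)"
    using assms by (simp add: ln_realpow)
  also have "\<dots> \<le> 2 * (\<bar>t\<bar> + M)"
    using ln_bound[of "\<bar>t\<bar> + M"] assms by (intro mult_left_mono) auto
  finally have upper: "ln (t\<^sup>2 + a\<^sup>2) / 2 \<le> M + \<bar>t\<bar>"
    by simp
  have "- neglog t \<le> ln \<bar>t\<bar>"
    using assms by (auto simp: neglog_def indicator_def)
  also have "2 * ln \<bar>t\<bar> = ln (t\<^sup>2)"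
    using ln_realpow[of "\<bar>t\<bar>" 2] assms by simp
  hence "ln \<bar>t\<bar> = ln (t\<^sup>2) / 2"
    by simp
  also have "ln (t\<^sup>2) \<le> ln (t\<^sup>2 + a\<^sup>2)"
    using assms by (intro ln_mono) auto
  finally have lower: "- neglog t \<le> ln (t\<^sup>2 + a\<^sup>2) / 2"
    by simp
  have "\<bar>ln (t\<^sup>2 + a\<^sup>2) / 2\<bar> \<le> (M + \<bar>t\<bar>) + neglog t"
    using upper lower assms neglog_nonneg[of t] by linarith
  hence "\<bar>ln (t\<^sup>2 + a\<^sup>2) / 2\<bar> * kern t \<le> ((M + \<bar>t\<bar>) + neglog t) * kern t"
    using kern_pos[of t] by (intro mult_right_mono) auto
  also have "\<dots> \<le> log_kern_dom M t"
    using mult_left_mono[OF kern_le_1 neglog_nonneg, of t t] by (simp add: log_kern_dom_def algebra_simps)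
  finally show ?thesis
    using kern_pos[of t] by (simp add: abs_mult)
qed

lemma AE_nonzero_lborel: "AE t in lborel. t \<noteq> (0::real)"
  by (rule AE_lborel_singleton)

lemma integrable_log_kern:
  assumes "a \<ge> 0"
  shows   "integrable lborel (\<lambda>t. ln (t\<^sup>2 + a\<^sup>2) / 2 * kern t)"
proof (rule Bochner_Integration.integrable_bound[OF integrable_log_kern_dom[of a]])
  show "AE t in lborel. norm (ln (t\<^sup>2 + a\<^sup>2) / 2 * kern t) \<le> norm (log_kern_dom a t)"
    using AE_nonzero_lborel by eventually_elim (use log_kern_bound[OF assms order.refl] in fastforce)
qed measurable

section \<open>Continuity and growth of \<open>logint\<close>\<close>

text \<open>Dominated convergence, with \<open>M\<close> a bound of the convergent sequence. The
  limit \<open>a = 0\<close> is allowed, which later carries the shift formula to the boundary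
  case.\<close>

lemma tendsto_logint:
  assumes "\<And>n. b n \<ge> 0" "b \<longlonglongrightarrow> a"
  shows   "(\<lambda>n. logint (b n)) \<longlonglongrightarrow> logint a"
proof -
  obtain M where "\<forall>n. norm (b n) \<le> M"
    using convergent_imp_Bseq[OF convergentI[OF assms(2)]] unfolding Bseq_def by blast
  hence M: "\<And>n. b n \<le> M"
    by (simp add: abs_le_iff)
  show ?thesis
    unfolding logint_def
  proof (rule integral_dominated_convergence)
    show "integrable lborel (log_kern_dom M)"
      by (rule integrable_log_kern_dom)
    show "AE t in lborel. norm (ln (t\<^sup>2 + (b n)\<^sup>2) / 2 * kern t) \<le> log_kern_dom M t" for n
      using AE_nonzero_lborel
      by eventually_elim (use log_kern_bound[OF assms(1) M] in auto)
    show "AE t in lborel. (\<lambda>n. ln (t\<^sup>2 + (b n)\<^sup>2) / 2 * kern t) \<longlonglongrightarrow> ln (t\<^sup>2 + a\<^sup>2) / 2 * kern t"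
      using AE_nonzero_lborel
      by eventually_elim (intro tendsto_intros assms, auto simp: sum_power2_eq_zero_iff)
  qed measurable
qed

text \<open>Splitting off \<open>ln a\<close> leaves \<open>ln (1 + (t / a)^2) / 2\<close>, which
  lies between \<open>0\<close> and \<open>\<bar>t\<bar> / a\<close>. The main term is thus
  \<open>ln a\<close> times the mass of the kernel, and the error is at most its first absolute
  moment divided by \<open>a\<close>.\<close>

lemma logint_asymp: "((\<lambda>a. logint a - 2 * pi / (3 * sqrt 3) * ln a) \<longlongrightarrow> 0) at_top"
proof (rule tendsto_sandwich)
  define C where "C = (LBINT t. \<bar>t\<bar> * kern t)"
  have *: "0 \<le> logint a - 2 * pi / (3 * sqrt 3) * ln a \<and> logint a - 2 * pi / (3 * sqrt 3) * ln a \<le> C / a"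
    if a: "a > 0" for a
  proof -
    have eq: "ln (t\<^sup>2 + a\<^sup>2) / 2 = ln (1 + (t / a)\<^sup>2) / 2 + ln a" for t
    proof -
      have "t\<^sup>2 + a\<^sup>2 = (1 + (t / a)\<^sup>2) * a\<^sup>2"
        using a by (simp add: field_simps)
      also have "ln \<dots> = ln (1 + (t / a)\<^sup>2) + ln (a\<^sup>2)"
        using a by (intro ln_mult_pos) (auto intro: add_pos_nonneg)
      finally show ?thesis
        using a by (simp add: ln_realpow)
    qed
    have "ln (1 + (t / a)\<^sup>2) / 2 \<le> \<bar>t\<bar> / a" for t
    proof -
      have "ln (1 + (t / a)\<^sup>2) \<le> ln ((1 + \<bar>t\<bar> / a)\<^sup>2)"
        using a by (intro ln_mono) (auto intro: add_pos_nonneg simp: power2_sum power_divide)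
      also have "\<dots> = 2 * ln (1 + \<bar>t\<bar> / a)"
        using a by (simp add: ln_realpow add_pos_nonneg)
      also have "\<dots> \<le> 2 * (\<bar>t\<bar> / a)"
        using a ln_add_one_self_le_self[of "\<bar>t\<bar> / a"] by simp
      finally show ?thesis by (simp add: field_simps)
    qed
    hence up: "ln (t\<^sup>2 + a\<^sup>2) / 2 * kern t - ln a * kern t \<le> \<bar>t\<bar> * kern t / a" for t
      using mult_right_mono[of "ln (1 + (t / a)\<^sup>2) / 2" "\<bar>t\<bar> / a" "kern t"] kern_pos[of t]
      by (simp only: eq) (simp add: algebra_simps)
    have lo: "0 \<le> ln (t\<^sup>2 + a\<^sup>2) / 2 * kern t - ln a * kern t" for t
      using kern_pos[of t] by (simp only: eq) (simp add: algebra_simps)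
    have int: "integrable lborel (\<lambda>t. ln (t\<^sup>2 + a\<^sup>2) / 2 * kern t - ln a * kern t)"
      using a by (intro Bochner_Integration.integrable_diff integrable_log_kern integrable_mult_right integrable_kern) auto
    have val: "(LBINT t. ln (t\<^sup>2 + a\<^sup>2) / 2 * kern t - ln a * kern t) = logint a - 2 * pi / (3 * sqrt 3) * ln a"
      using a integrable_log_kern[of a] integrable_kern
      by (subst Bochner_Integration.integral_diff) (simp_all add: logint_def integral_kern)
    have "0 \<le> (LBINT t. ln (t\<^sup>2 + a\<^sup>2) / 2 * kern t - ln a * kern t)"
      using lo by (intro Bochner_Integration.integral_nonneg) auto
    moreover have "(LBINT t. ln (t\<^sup>2 + a\<^sup>2) / 2 * kern t - ln a * kern t) \<le> (LBINT t. \<bar>t\<bar> * kern t / a)"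
      using up by (intro Bochner_Integration.integral_mono int integrable_divide integrable_abs_mult_kern)
    ultimately show ?thesis
      unfolding val by (simp add: C_def)
  qed
  show "\<forall>\<^sub>F a in at_top. 0 \<le> logint a - 2 * pi / (3 * sqrt 3) * ln a"
    using eventually_gt_at_top[of 0] by eventually_elim (use * in blast)
  show "\<forall>\<^sub>F a in at_top. logint a - 2 * pi / (3 * sqrt 3) * ln a \<le> C / a"
    using eventually_gt_at_top[of 0] by eventually_elim (use * in blast)
  show "((\<lambda>a. C / a) \<longlongrightarrow> 0) at_top"
    by real_asymp
qed (rule tendsto_const)

section \<open>Preparations for the contour integral\<close>

text \<open>Connects the gauge integrals over horizontal sides of rectangles with Lebesgue integrals
  over the line; \<open>\<bar>f\<bar>\<close> dominates the truncations.\<close>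

lemma tendsto_integral_symmetric_interval:
  fixes f :: "real \<Rightarrow> real"
  assumes f: "integrable lborel f"
  shows   "(\<lambda>n. integral {-real n..real n} f) \<longlonglongrightarrow> (LBINT t. f t)"
proof -
  have [measurable]: "f \<in> borel_measurable borel"
    using borel_measurable_integrable[OF f] by simp
  have "set_integrable lborel {-real n..real n} f" for n
    using f unfolding set_integrable_def by (intro integrable_mult_indicator) auto
  hence "integral {-real n..real n} f = (LBINT t. indicator {-real n..real n} t *\<^sub>R f t)" for n
    by (simp flip: set_borel_integral_eq_integral(2) add: set_lebesgue_integral_def)
  moreover have "(\<lambda>n. LBINT t. indicator {-real n..real n} t *\<^sub>R f t) \<longlonglongrightarrow> (LBINT t. f t)"
  proof (rule integral_dominated_convergence)
    show "integrable lborel (\<lambda>t. norm (f t))"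
      using f by simp
    show "AE t in lborel. (\<lambda>n. indicator {-real n..real n} t *\<^sub>R f t) \<longlonglongrightarrow> f t"
    proof (rule AE_I2)
      fix t :: real
      have "eventually (\<lambda>n. indicator {-real n..real n} t *\<^sub>R f t = f t) sequentially"
        using eventually_ge_at_top[of "nat \<lceil>\<bar>t\<bar>\<rceil>"]
        by eventually_elim (auto simp: indicator_def abs_le_iff nat_le_iff ceiling_le_iff)
      thus "(\<lambda>n. indicator {-real n..real n} t *\<^sub>R f t) \<longlonglongrightarrow> f t"
        by (rule tendsto_eventually)
    qed
  qed (auto simp: indicator_def)
  ultimately show ?thesis by simp
qed

text \<open>Translating by \<open>\<i> * c\<close> moves the segment to the real axis, where contour
  integrals are ordinary ones. Real parts suffice since \<open>ln \<bar>z\<bar>\<close> is the real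
  part of \<open>Ln z\<close>.\<close>

lemma has_integral_Re_horizontal_linepath:
  assumes "f contour_integrable_on linepath (Complex u c) (Complex v c)" "u < v"
  shows   "((\<lambda>x. Re (f (Complex x c))) has_integral
             Re (contour_integral (linepath (Complex u c) (Complex v c)) f)) {u..v}"
proof -
  let ?I = "contour_integral (linepath (Complex u c) (Complex v c)) f"
  define g where "g = (\<lambda>z. f (z + \<i> * of_real c))"
  have "(f has_contour_integral ?I) (linepath (Complex u c) (Complex v c))"
    using assms(1) by (rule has_contour_integral_integral)
  moreover have "linepath (Complex u c) (Complex v c) x = linepath (of_real u) (of_real v) x + \<i> * of_real c" for x
    by (auto simp: linepath_def complex_eq_iff algebra_simps)
  moreover have "Complex v c - Complex u c = of_real v - of_real u"
    by (auto simp: complex_eq_iff)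
  ultimately have "(g has_contour_integral ?I) (linepath (of_real u) (of_real v))"
    by (simp add: has_contour_integral_linepath g_def)
  hence "((\<lambda>x. g (of_real x)) has_integral ?I) {u..v}"
    using assms(2) by (subst (asm) has_contour_integral_linepath_Reals_iff) auto
  hence "((\<lambda>x. Re (g (of_real x))) has_integral Re ?I) {u..v}"
    by (rule has_integral_linear[OF _ bounded_linear_Re, unfolded o_def])
  moreover have "of_real x + \<i> * of_real c = Complex x c" for x
    by (auto simp: complex_eq_iff)
  ultimately show ?thesis
    by (simp add: g_def)
qed

text \<open>Here \<open>exp z\<close> is a root of \<open>e^2 + e + 1\<close>, hence a cube root of
  unity other than \<open>1\<close>. Among the multiples of \<open>3\<close> only \<open>0\<close>
  and \<open>3\<close> are excluded, since no others occur in the strip considered below.\<close>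

lemma exp_plus_1_plus_exp_minus_eq_0D:
  fixes z :: complex
  assumes "exp z + 1 + exp (- z) = 0"
  obtains n :: int where "Re z = 0" "Im z = 2 * pi * of_int n / 3" "n \<noteq> 0" "n \<noteq> 3"
proof -
  define e where "e = exp z"
  have "e \<noteq> 0"
    by (simp add: e_def)
  have *: "e ^ 2 + e + 1 = 0"
    using assms \<open>e \<noteq> 0\<close> by (simp add: exp_minus e_def [symmetric] field_simps power2_eq_square)
  have "e ^ 3 - 1 = (e - 1) * (e ^ 2 + e + 1)"
    by (simp add: algebra_simps power2_eq_square power3_eq_cube)
  hence "exp (3 * z) = 1"
    using * exp_of_nat_mult[of 3 z] by (simp add: e_def)
  then obtain n :: int where "Re (3 * z) = 0" "Im (3 * z) = of_int (2 * n) * pi"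
    unfolding exp_eq_1 by blast
  hence n: "Re z = 0" "Im z = 2 * pi * of_int n / 3"
    by (simp_all add: field_simps)
  have "e \<noteq> 1"
    using * by auto
  moreover have "e = 1" if "n = 0 \<or> n = 3"
    unfolding e_def exp_eq_1 using that n by (auto intro: exI[of _ 0] exI[of _ 1])
  ultimately show ?thesis
    using that n by blast
qed

text \<open>Linear growth is enough, as the denominator grows exponentially on the vertical sides.
  The assumption makes \<open>ln (norm z)\<close> nonnegative, so \<open>ln x \<le> x\<close> bounds
  its absolute value.\<close>

lemma norm_Ln_le:
  assumes "norm z \<ge> 1"
  shows   "norm (Ln z) \<le> norm z + pi"
proof -
  have z: "z \<noteq> 0"
    using assms by auto
  have "norm (Ln z) \<le> \<bar>Re (Ln z)\<bar> + \<bar>Im (Ln z)\<bar>"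
    by (rule cmod_le)
  also have "\<bar>Re (Ln z)\<bar> \<le> norm z"
    using z assms ln_bound[of "norm z"] by simp
  also have "\<bar>Im (Ln z)\<bar> \<le> pi"
    using mpi_less_Im_Ln[OF z] Im_Ln_le_pi[OF z] by linarith
  finally show ?thesis by simp
qed

section \<open>Residues and integration around a rectangle\<close>

text \<open>The strip \<open>S\<close> is a neighbourhood of
  \<open>0 \<le> Im z \<le> 2 * pi\<close>. The margin \<open>a\<close> keeps
  \<open>of_real a - \<i> * z\<close> in the right half-plane, off the branch cut; the bounds
  \<open>-2\<close> and \<open>8\<close> shut out the zeros of the denominator at
  \<open>-2 * pi / 3\<close> and \<open>8 * pi / 3\<close> on the imaginary axis. Both poles are
  simple, so each residue is the numerator over the derivative of the denominator.\<close>

lemma residues_log_kernel: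
  fixes a :: real
  assumes a: "a > 0"
  defines "S \<equiv> {z. - min a 2 < Im z \<and> Im z < 8}"
  defines "f \<equiv> (\<lambda>z. Ln (of_real a - \<i> * z) / (exp z + 1 + exp (- z)))"
  defines "p \<equiv> Complex 0 (2 * pi / 3)" and "q \<equiv> Complex 0 (4 * pi / 3)"
  shows   "open S" "convex S" "f holomorphic_on S - {p, q}"
          "residue f p = of_real (ln (a + 2 * pi / 3)) / (\<i> * of_real (sqrt 3))"
          "residue f q = - of_real (ln (a + 4 * pi / 3)) / (\<i> * of_real (sqrt 3))"
proof -
  have S_eq: "S = {z. Im z > - min a 2} \<inter> {z. Im z < 8}"
    by (auto simp: S_def)
  show S: "open S" "convex S"
    unfolding S_eq by (auto intro!: open_Int convex_Int open_halfspace_Im_gt open_halfspace_Im_lt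
                              convex_halfspace_Im_gt convex_halfspace_Im_lt)
  have nonneg: "of_real a - \<i> * z \<notin> \<real>\<^sub>\<le>\<^sub>0" if "z \<in> S" for z
    using that a by (auto simp: S_def complex_nonpos_Reals_iff)
  have num: "(\<lambda>z. Ln (of_real a - \<i> * z)) holomorphic_on S"
    by (intro holomorphic_intros) (use nonneg in auto)
  have den: "(\<lambda>z. exp z + 1 + exp (- z)) holomorphic_on S"
    by (intro holomorphic_intros)
  have zero: "z \<in> {p, q}" if z: "z \<in> S" "exp z + 1 + exp (- z) = 0" for z
  proof -
    obtain n :: int where n: "Re z = 0" "Im z = 2 * pi * of_int n / 3" "n \<noteq> 0" "n \<noteq> 3"
      using exp_plus_1_plus_exp_minus_eq_0D[OF z(2)] .
    \<comment> \<open>With the bounds \<open>-2\<close> and \<open>8\<close> scaled by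
      \<open>3 / 2\<close>, the estimate \<open>pi > 3\<close> already rules out
      \<open>n \<le> -1\<close> and \<open>n \<ge> 4\<close>.\<close>
    have bounds: "- 3 < pi * of_int n" "pi * of_int n < 12"
      using z(1) n(2) by (auto simp: S_def)
    have "n > -1"
    proof (rule ccontr)
      assume "\<not> n > -1"
      hence "pi * of_int n \<le> pi * (-1)"
        by (intro mult_left_mono) auto
      thus False using bounds pi_gt3 by linarith
    qed
    moreover have "n < 4"
    proof (rule ccontr)
      assume "\<not> n < 4"
      hence "pi * of_int n \<ge> pi * 4"
        by (intro mult_left_mono) auto
      thus False using bounds pi_gt3 by linarith
    qed
    ultimately have "n = 1 \<or> n = 2"
      using n by auto
    thus ?thesis
      using n by (auto simp: p_def q_def complex_eq_iff)
  qed
  show "f holomorphic_on S - {p, q}"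
    unfolding f_def
    by (intro holomorphic_on_divide holomorphic_on_subset[OF num] holomorphic_on_subset[OF den])
       (use zero in auto)
  have inS: "p \<in> S" "q \<in> S"
    using a pi_less_4 by (auto simp: S_def p_def q_def intro: less_trans[of _ 0])
  have exps: "exp p = Complex (-1/2) (sqrt 3 / 2)" "exp (-p) = Complex (-1/2) (- sqrt 3 / 2)"
    by (auto simp: complex_eq_iff p_def Re_exp Im_exp cos_120 sin_120)
  have "cos (4 * pi / 3) = cos (2 * pi / 3)"
    using cos_2pi_minus[of "2 * pi / 3"] by simp
  moreover have "sin (4 * pi / 3) = - sin (2 * pi / 3)"
    using sin_2pi_minus[of "2 * pi / 3"] by simp
  ultimately have expsq: "exp q = Complex (-1/2) (- sqrt 3 / 2)" "exp (-q) = Complex (-1/2) (sqrt 3 / 2)"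
    by (auto simp: complex_eq_iff q_def Re_exp Im_exp cos_120 sin_120)
  have lnp: "Ln (of_real a - \<i> * p) = of_real (ln (a + 2 * pi / 3))"
  proof -
    have "of_real a - \<i> * p = of_real (a + 2 * pi / 3)"
      by (simp add: p_def complex_eq_iff)
    thus ?thesis
      using a by (simp only: Ln_of_real add_pos_pos divide_pos_pos mult_pos_pos pi_gt_zero zero_less_numeral)
  qed
  have lnq: "Ln (of_real a - \<i> * q) = of_real (ln (a + 4 * pi / 3))"
  proof -
    have "of_real a - \<i> * q = of_real (a + 4 * pi / 3)"
      by (simp add: q_def complex_eq_iff)
    thus ?thesis
      using a by (simp only: Ln_of_real add_pos_pos divide_pos_pos mult_pos_pos pi_gt_zero zero_less_numeral)
  qed
  \<comment> \<open>The residue rule requires a nonzero numerator; both arguments exceed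
    \<open>2\<close>.\<close>
  have "ln (a + 2 * pi / 3) \<noteq> 0" "ln (a + 4 * pi / 3) \<noteq> 0"
    using a pi_gt3 by (auto simp: ln_eq_zero_iff)
  hence nz: "Ln (of_real a - \<i> * p) \<noteq> 0" "Ln (of_real a - \<i> * q) \<noteq> 0"
    unfolding lnp lnq by auto
  have "connected S"
    using S by (simp add: convex_connected)
  have der: "((\<lambda>z. exp z + 1 + exp (- z)) has_field_derivative exp z - exp (- z)) (at z)" for z :: complex
    by (auto intro!: derivative_eq_intros)
  have diffs: "exp p - exp (- p) = \<i> * of_real (sqrt 3)" "exp q - exp (- q) = - (\<i> * of_real (sqrt 3))"
    unfolding exps expsq by (simp_all add: complex_eq_iff)
  have "exp p + 1 + exp (- p) = 0" "exp p - exp (- p) \<noteq> 0"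
       "exp q + 1 + exp (- q) = 0" "exp q - exp (- q) \<noteq> 0"
    unfolding exps expsq by (simp_all add: complex_eq_iff)
  note zeros = this
  have "residue f p = Ln (of_real a - \<i> * p) / (exp p - exp (- p))"
    unfolding f_def
    by (rule residue_simple_pole_deriv[OF num den \<open>open S\<close> \<open>connected S\<close> inS(1) der nz(1) zeros(1,2)])
  thus "residue f p = of_real (ln (a + 2 * pi / 3)) / (\<i> * of_real (sqrt 3))"
    unfolding lnp diffs(1) .
  have "residue f q = Ln (of_real a - \<i> * q) / (exp q - exp (- q))"
    unfolding f_def
    by (rule residue_simple_pole_deriv[OF num den \<open>open S\<close> \<open>connected S\<close> inS(2) der nz(2) zeros(3,4)])
  thus "residue f q = - of_real (ln (a + 4 * pi / 3)) / (\<i> * of_real (sqrt 3))"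
    unfolding lnq diffs(2) by simp
qed

text \<open>One of \<open>exp z\<close>, \<open>exp (- z)\<close> has modulus \<open>exp R\<close>,
  and the other terms of the denominator contribute at most \<open>1 + exp (- R)\<close>. In the
  numerator, \<open>3 * pi\<close> is \<open>2 * pi\<close> from \<open>Im z\<close> plus
  \<open>pi\<close> from the argument of the logarithm.\<close>

lemma log_kernel_vertical_bound:
  assumes a: "a > 0" and R: "R \<ge> 2" "\<bar>Re z\<bar> = R" and Im: "0 \<le> Im z" "Im z \<le> 2 * pi"
  shows   "norm (Ln (of_real a - \<i> * z) / (exp z + 1 + exp (- z)))
             \<le> (a + R + 3 * pi) / (exp R - exp (- R) - 1)"
  unfolding norm_divide
proof (rule frac_le)
  have "exp R \<ge> 1 + R"
    by simp
  moreover have "exp (- R) < 1"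
    using R by simp
  ultimately show "exp R - exp (- R) - 1 > 0"
    using R by linarith
  have "norm (of_real a - \<i> * z) \<ge> \<bar>Im (of_real a - \<i> * z)\<bar>"
    by (rule abs_Im_le_cmod)
  hence "norm (of_real a - \<i> * z) \<ge> 1"
    using R by simp
  hence "norm (Ln (of_real a - \<i> * z)) \<le> norm (of_real a - \<i> * z) + pi"
    by (rule norm_Ln_le)
  also have "norm (of_real a - \<i> * z) \<le> \<bar>Re (of_real a - \<i> * z)\<bar> + \<bar>Im (of_real a - \<i> * z)\<bar>"
    by (rule cmod_le)
  also have "\<dots> \<le> a + R + 2 * pi"
    using assms by simp
  finally show "norm (Ln (of_real a - \<i> * z)) \<le> a + R + 3 * pi"
    by simp
  show "exp R - exp (- R) - 1 \<le> norm (exp z + 1 + exp (- z))"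
  proof (cases "Re z \<ge> 0")
    case True
    have "norm (exp z) \<le> norm (exp z + 1 + exp (- z)) + norm (1 + exp (- z))"
      using norm_triangle_ineq4[of "exp z + 1 + exp (- z)" "1 + exp (- z)"] by simp
    also have "norm (1 + exp (- z)) \<le> 1 + norm (exp (- z))"
      using norm_triangle_ineq[of 1 "exp (- z)"] by simp
    finally show ?thesis
      using True R by (simp add: norm_exp_eq_Re)
  next
    case False
    have "norm (exp (- z)) \<le> norm (exp z + 1 + exp (- z)) + norm (1 + exp z)"
      using norm_triangle_ineq4[of "exp z + 1 + exp (- z)" "1 + exp z"] by (simp add: algebra_simps)
    also have "norm (1 + exp z) \<le> 1 + norm (exp z)"
      using norm_triangle_ineq[of 1 "exp z"] by simp
    finally show ?thesis
      using False R(2)[symmetric] by (simp add: norm_exp_eq_Re)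
  qed
qed (use assms in auto)

text \<open>The residue theorem on the rectangle with base \<open>[-R, R]\<close> and height
  \<open>2 * pi\<close>. The real parts over the horizontal sides are \<open>h a\<close> and
  \<open>h (a + 2 * pi)\<close>; the right-hand side bounds the two vertical sides, each of length
  \<open>2 * pi\<close>.\<close>

lemma rectangle_log_kernel:
  fixes a R :: real
  assumes a: "a > 0" and R: "R \<ge> 2"
  defines "h \<equiv> (\<lambda>a. integral {-R..R} (\<lambda>t. ln (t\<^sup>2 + a\<^sup>2) / 2 * kern t))"
  shows   "\<bar>h a - h (a + 2 * pi) - 2 * pi / sqrt 3 * (ln (a + 2 * pi / 3) - ln (a + 4 * pi / 3))\<bar>
             \<le> 4 * pi * ((a + R + 3 * pi) / (exp R - exp (- R) - 1))"
proof -
  define S where "S = {z. - min a 2 < Im z \<and> Im z < 8}"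
  define f where "f = (\<lambda>z. Ln (of_real a - \<i> * z) / (exp z + 1 + exp (- z)))"
  define p where "p = Complex 0 (2 * pi / 3)"
  define q where "q = Complex 0 (4 * pi / 3)"
  define B where "B = (a + R + 3 * pi) / (exp R - exp (- R) - 1)"
  note res = residues_log_kernel[OF a, folded S_def f_def p_def q_def]
  define a1 where "a1 = Complex (-R) 0"
  define a2 where "a2 = Complex R 0"
  define a3 where "a3 = Complex R (2 * pi)"
  define a4 where "a4 = Complex (-R) (2 * pi)"
  have rect: "rectpath a1 a3 = linepath a1 a2 +++ linepath a2 a3 +++ linepath a3 a4 +++ linepath a4 a1"
    by (simp add: rectpath_def a1_def a2_def a3_def a4_def Let_def)
  have "p \<noteq> q"
    by (simp add: p_def q_def)
  have box: "p \<in> box a1 a3" "q \<in> box a1 a3"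
    using R by (auto simp: in_box_complex_iff a1_def a3_def p_def q_def)
  have cboxS: "cbox a1 a3 \<subseteq> S"
    using a R pi_less_4 by (auto simp: in_cbox_complex_iff a1_def a3_def S_def)
  have img: "path_image (rectpath a1 a3) = cbox a1 a3 - box a1 a3"
    using R by (intro path_image_rectpath_cbox_minus_box) (auto simp: a1_def a3_def)
  have img': "path_image (rectpath a1 a3) = closed_segment a1 a2 \<union> closed_segment a2 a3 \<union>
                closed_segment a3 a4 \<union> closed_segment a4 a1"
    unfolding rect by (simp add: path_image_join Un_assoc)
  have cont: "continuous_on (path_image (rectpath a1 a3)) f"
    using res(3) box cboxS unfolding img
    by (intro holomorphic_on_imp_continuous_on) (auto elim: holomorphic_on_subset)
  have seg: "f contour_integrable_on linepath a1 a2" "f contour_integrable_on linepath a2 a3"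
            "f contour_integrable_on linepath a3 a4" "f contour_integrable_on linepath a4 a1"
            "f contour_integrable_on linepath a4 a3"
    by (rule contour_integrable_continuous_linepath; rule continuous_on_subset[OF cont];
        use img' in \<open>auto simp: closed_segment_commute\<close>)+
  have "contour_integral (rectpath a1 a3) f =
          2 * pi * \<i> * (\<Sum>z\<in>{p, q}. winding_number (rectpath a1 a3) z * residue f z)"
  proof (rule Residue_theorem[of S])
    show "\<forall>z. z \<notin> S \<longrightarrow> winding_number (rectpath a1 a3) z = 0"
      using cboxS img res(2) by (auto intro!: winding_number_zero_outside[of _ S])
  qed (use res cboxS img box in \<open>auto simp: convex_connected\<close>)
  also have "\<dots> = 2 * pi * \<i> * (residue f p + residue f q)"
    using \<open>p \<noteq> q\<close> by (simp add: winding_number_rectpath box)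
  \<comment> \<open>The factor \<open>\<i>\<close> cancels against the denominators of the residues,
    so the value is real.\<close>
  also have "\<dots> = of_real (2 * pi / sqrt 3 * (ln (a + 2 * pi / 3) - ln (a + 4 * pi / 3)))"
    unfolding res by (simp add: field_simps)
  finally have total: "contour_integral (rectpath a1 a3) f =
                 of_real (2 * pi / sqrt 3 * (ln (a + 2 * pi / 3) - ln (a + 4 * pi / 3)))" .
  \<comment> \<open>The top side is traversed from right to left; reversing it gives an integral
    over increasing \<open>x\<close>.\<close>
  have "contour_integral (linepath a3 a4) f = - contour_integral (linepath a4 a3) f"
    by (rule contour_integral_reverse_linepath, rule continuous_on_subset[OF cont]) (use img' in auto)
  hence split: "contour_integral (rectpath a1 a3) f = contour_integral (linepath a1 a2) f +
      contour_integral (linepath a2 a3) f - contour_integral (linepath a4 a3) f + contour_integral (linepath a4 a1) f"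
    using seg unfolding rect by simp
  have "((\<lambda>x. Re (f (Complex x 0))) has_integral Re (contour_integral (linepath a1 a2) f)) {-R..R}"
    unfolding a1_def a2_def using seg R
    by (intro has_integral_Re_horizontal_linepath) (auto simp: a1_def a2_def)
  moreover have "Re (f (Complex x 0)) = ln (x\<^sup>2 + a\<^sup>2) / 2 * kern x" for x
  proof -
    have "exp (Complex x 0) = of_real (exp x)" "exp (- Complex x 0) = of_real (exp (- x))"
      by (auto simp: complex_eq_iff Re_exp Im_exp)
    moreover have "of_real a - \<i> * Complex x 0 = Complex a (- x)"
      by (simp add: complex_eq_iff)
    ultimately have "f (Complex x 0) = Ln (Complex a (- x)) * of_real (kern x)"
      unfolding f_def by (simp add: kern_def divide_inverse)
    moreover have "Complex a (-x) \<noteq> 0"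
      using a by (simp add: complex_eq_iff)
    ultimately show ?thesis
      by (simp add: cmod_def ln_sqrt add_pos_nonneg a add_ac)
  qed
  ultimately have "((\<lambda>x. ln (x\<^sup>2 + a\<^sup>2) / 2 * kern x) has_integral
                      Re (contour_integral (linepath a1 a2) f)) {-R..R}"
    by (simp only:)
  hence h1: "Re (contour_integral (linepath a1 a2) f) = h a"
    unfolding h_def by (rule integral_unique [symmetric])
  have "((\<lambda>x. Re (f (Complex x (2 * pi)))) has_integral Re (contour_integral (linepath a4 a3) f)) {-R..R}"
    unfolding a4_def a3_def using seg R
    by (intro has_integral_Re_horizontal_linepath) (auto simp: a4_def a3_def)
  \<comment> \<open>Periodicity restores the kernel, while
    \<open>a - \<i> * (x + 2 * pi * \<i>) = (a + 2 * pi) - \<i> * x\<close> shifts the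
    parameter.\<close>
  moreover have "Re (f (Complex x (2 * pi))) = ln (x\<^sup>2 + (a + 2 * pi)\<^sup>2) / 2 * kern x" for x
  proof -
    have "exp (Complex x (2 * pi)) = of_real (exp x)" "exp (- Complex x (2 * pi)) = of_real (exp (- x))"
      by (auto simp: complex_eq_iff Re_exp Im_exp)
    moreover have "of_real a - \<i> * Complex x (2 * pi) = Complex (a + 2 * pi) (- x)"
      by (simp add: complex_eq_iff)
    ultimately have "f (Complex x (2 * pi)) = Ln (Complex (a + 2 * pi) (- x)) * of_real (kern x)"
      unfolding f_def by (simp add: kern_def divide_inverse)
    moreover have a': "a + 2 * pi > 0"
      using a by (simp add: add_pos_pos)
    moreover from this have "Complex (a + 2 * pi) (-x) \<noteq> 0"
      by (simp add: complex_eq_iff)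
    ultimately show ?thesis
      by (simp add: cmod_def ln_sqrt add_pos_nonneg add_ac)
  qed
  ultimately have "((\<lambda>x. ln (x\<^sup>2 + (a + 2 * pi)\<^sup>2) / 2 * kern x) has_integral
                      Re (contour_integral (linepath a4 a3) f)) {-R..R}"
    by (simp only:)
  hence h2: "Re (contour_integral (linepath a4 a3) f) = h (a + 2 * pi)"
    unfolding h_def by (rule integral_unique [symmetric])
  have B: "norm (f z) \<le> B" if "\<bar>Re z\<bar> = R" "0 \<le> Im z" "Im z \<le> 2 * pi" for z
    unfolding f_def B_def by (rule log_kernel_vertical_bound[OF a R that])
  have "B \<ge> 0"
    using R by (intro order_trans[OF norm_ge_zero B[of "Complex R 0"]]) auto
  have side1: "norm (contour_integral (linepath a2 a3) f) \<le> B * norm (a3 - a2)"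
    by (rule contour_integral_bound_linepath[OF seg(2) \<open>B \<ge> 0\<close>])
       (use R in \<open>auto intro!: B simp: a2_def a3_def closed_segment_same_Re closed_segment_eq_real_ivl split: if_splits\<close>)
  have side2: "norm (contour_integral (linepath a4 a1) f) \<le> B * norm (a1 - a4)"
    by (rule contour_integral_bound_linepath[OF seg(4) \<open>B \<ge> 0\<close>])
       (use R in \<open>auto intro!: B simp: a1_def a4_def closed_segment_same_Re closed_segment_eq_real_ivl split: if_splits\<close>)
  have "norm (a3 - a2) = 2 * pi" "norm (a1 - a4) = 2 * pi"
    by (simp_all add: a1_def a2_def a3_def a4_def cmod_def real_sqrt_mult)
  with side1 side2 have sides:
    "\<bar>Re (contour_integral (linepath a2 a3) f)\<bar> \<le> 2 * pi * B"
    "\<bar>Re (contour_integral (linepath a4 a1) f)\<bar> \<le> 2 * pi * B"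
    using abs_Re_le_cmod[of "contour_integral (linepath a2 a3) f"]
          abs_Re_le_cmod[of "contour_integral (linepath a4 a1) f"] by (simp_all add: mult_ac)
  have "h a - h (a + 2 * pi) - 2 * pi / sqrt 3 * (ln (a + 2 * pi / 3) - ln (a + 4 * pi / 3)) =
        - (Re (contour_integral (linepath a2 a3) f) + Re (contour_integral (linepath a4 a1) f))"
    using arg_cong[OF split, of Re] unfolding total h1 h2 by (simp add: h1 h2)
  thus ?thesis
    using sides unfolding B_def [symmetric] by linarith
qed

section \<open>The shift formula and its iteration\<close>

lemma logint_shift_pos:
  assumes a: "a > 0"
  shows   "logint (a + 2 * pi) - logint a = 2 * pi / sqrt 3 * (ln (a + 4 * pi / 3) - ln (a + 2 * pi / 3))"
proof -
  define h where "h = (\<lambda>R a. integral {-R..R} (\<lambda>t. ln (t\<^sup>2 + a\<^sup>2) / 2 * kern t))"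
  define c where "c = 2 * pi / sqrt 3 * (ln (a + 2 * pi / 3) - ln (a + 4 * pi / 3))"
  have "(\<lambda>n. h (real n) b) \<longlonglongrightarrow> logint b" if "b \<ge> 0" for b
    unfolding h_def logint_def
    by (intro tendsto_integral_symmetric_interval integrable_log_kern that)
  hence 1: "(\<lambda>n. h (real n) a - h (real n) (a + 2 * pi) - c) \<longlonglongrightarrow> logint a - logint (a + 2 * pi) - c"
    using a by (intro tendsto_intros) auto
  have 2: "(\<lambda>n. h (real n) a - h (real n) (a + 2 * pi) - c) \<longlonglongrightarrow> 0"
  proof (rule Lim_null_comparison)
    show "\<forall>\<^sub>F n in sequentially. norm (h (real n) a - h (real n) (a + 2 * pi) - c) \<le>
             4 * pi * ((a + real n + 3 * pi) / (exp (real n) - exp (- real n) - 1))"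
      using eventually_ge_at_top[of 2]
      by eventually_elim (use rectangle_log_kernel[OF a] in \<open>auto simp: h_def c_def\<close>)
    show "(\<lambda>n. 4 * pi * ((a + real n + 3 * pi) / (exp (real n) - exp (- real n) - 1))) \<longlonglongrightarrow> 0"
      by real_asymp
  qed
  show ?thesis
    using LIMSEQ_unique[OF 1 2] by (simp add: c_def algebra_simps)
qed

text \<open>For \<open>a = 0\<close> the branch point \<open>- \<i> * a\<close> of the logarithm
  lies on the contour, so this case is reached as a limit of positive parameters.\<close>

lemma logint_shift:
  assumes "a \<ge> 0"
  shows   "logint (a + 2 * pi) - logint a = 2 * pi / sqrt 3 * (ln (a + 4 * pi / 3) - ln (a + 2 * pi / 3))"
proof -
  define b where "b = (\<lambda>n. a + 1 / real (Suc n))"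
  have b: "b n > 0" for n
    using assms by (auto simp: b_def intro: add_nonneg_pos)
  have lim: "b \<longlonglongrightarrow> a"
    unfolding b_def by real_asymp
  have "(\<lambda>n. logint (b n + 2 * pi) - logint (b n)) \<longlonglongrightarrow> logint (a + 2 * pi) - logint a"
    by (intro tendsto_diff tendsto_logint tendsto_add lim tendsto_const less_imp_le add_pos_pos b) auto
  moreover have "(\<lambda>n. 2 * pi / sqrt 3 * (ln (b n + 4 * pi / 3) - ln (b n + 2 * pi / 3))) \<longlonglongrightarrow>
                 2 * pi / sqrt 3 * (ln (a + 4 * pi / 3) - ln (a + 2 * pi / 3))"
    using assms by (intro tendsto_intros lim) (auto simp: add_nonneg_eq_0_iff)
  ultimately show ?thesis
    using b by (simp add: logint_shift_pos LIMSEQ_unique)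
qed

text \<open>The shifts telescope: at \<open>a = 2 * pi * n\<close> the factor \<open>2 * pi\<close>
  cancels and the step contributes the logarithm of \<open>(n + 2/3) / (n + 1/3)\<close>.\<close>

lemma logint_2pi_nat:
  "logint (2 * pi * real n) = logint 0 + 2 * pi / sqrt 3 * ln (pochhammer (2 / 3) n / pochhammer (1 / 3) n)"
proof (induction n)
  case (Suc n)
  have "2 * pi * real n + 4 * pi / 3 = 2 * pi * (real n + 2 / 3)"
       "2 * pi * real n + 2 * pi / 3 = 2 * pi * (real n + 1 / 3)"
    by (simp_all add: field_simps)
  hence "ln (2 * pi * real n + 4 * pi / 3) - ln (2 * pi * real n + 2 * pi / 3) =
         ln (2 / 3 + real n) - ln (1 / 3 + real n)"
    by (simp only:) (simp add: ln_mult_pos add_nonneg_pos add_ac)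
  moreover have "pochhammer (2 / 3 :: real) n > 0" "pochhammer (1 / 3 :: real) n > 0"
    by (auto intro: pochhammer_pos)
  moreover from this have "ln (pochhammer (2 / 3) (Suc n) / pochhammer (1 / 3) (Suc n)) =
      ln (pochhammer (2 / 3) n / pochhammer (1 / 3) n) + (ln (2 / 3 + real n) - ln (1 / 3 + real n))"
    by (simp add: pochhammer_Suc ln_mult_pos ln_div add_pos_nonneg)
  moreover have "2 * pi * real (Suc n) = 2 * pi * real n + 2 * pi"
    by (simp add: algebra_simps)
  ultimately show ?case
    using logint_shift[of "2 * pi * real n"] Suc.IH
    by (simp only:) (simp add: algebra_simps)
qed auto

section \<open>Evaluation at \<open>0\<close> by Euler's limit\<close>

lemma logint_0: "logint 0 = 2 * pi / sqrt 3 * ln (root 3 (2 * pi) * Gamma (2 / 3) / Gamma (1 / 3))"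
proof -
  \<comment> \<open>The logarithm of the Pochhammer ratio with its growth \<open>ln n / 3\<close>
    removed. In the quotient of the Euler products the factorials cancel, and \<open>P n\<close> is
    exactly its logarithm for \<open>n > 0\<close>.\<close>
  define P :: "nat \<Rightarrow> real" where "P = (\<lambda>n. ln (pochhammer (2 / 3) n / pochhammer (1 / 3) n) - ln n / 3)"
  have "(\<lambda>n. ln (Gamma_series' (1 / 3) n / Gamma_series' (2 / 3) n)) \<longlonglongrightarrow> ln (Gamma (1 / 3) / Gamma (2 / 3 :: real))"
    by (intro tendsto_intros Gamma_series'_LIMSEQ) (auto simp: Gamma_eq_zero_iff)
  moreover have "eventually (\<lambda>n. ln (Gamma_series' (1 / 3) n / Gamma_series' (2 / 3) n) = P n) sequentially"
    using eventually_gt_at_top[of 0]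
  proof eventually_elim
    case (elim n)
    have pos: "pochhammer (2 / 3 :: real) n > 0" "pochhammer (1 / 3 :: real) n > 0"
      by (auto intro: pochhammer_pos)
    have "Gamma_series' (1 / 3) n / Gamma_series' (2 / 3) n =
          pochhammer (2 / 3) n / pochhammer (1 / 3) n * exp (- (ln (real n) / 3))"
      using pos by (simp add: Gamma_series'_def field_simps flip: exp_add)
    thus ?case
      using pos by (simp only:) (subst ln_mult_pos, auto simp: P_def)
  qed
  ultimately have P: "P \<longlonglongrightarrow> ln (Gamma (1 / 3) / Gamma (2 / 3))"
    by (rule Lim_transform_eventually)
  have "filterlim (\<lambda>n. 2 * pi * real n) at_top sequentially"
    by real_asymp
  hence "(\<lambda>n. logint (2 * pi * real n) - 2 * pi / (3 * sqrt 3) * ln (2 * pi * real n)) \<longlonglongrightarrow> 0"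
    by (rule filterlim_compose[OF logint_asymp])
  \<comment> \<open>Since \<open>2 * pi / (3 * sqrt 3)\<close> is a third of
    \<open>2 * pi / sqrt 3\<close>, the \<open>ln n\<close> terms combine into \<open>P n\<close>,
    leaving only the constant \<open>ln (2 * pi) / 3\<close>, the source of the cube root.\<close>
  moreover have "eventually (\<lambda>n. logint (2 * pi * real n) - 2 * pi / (3 * sqrt 3) * ln (2 * pi * real n) =
                    logint 0 + 2 * pi / sqrt 3 * (P n - ln (2 * pi) / 3)) sequentially"
    using eventually_gt_at_top[of 0]
  proof eventually_elim
    case (elim n)
    have "ln (2 * pi * real n) = ln (2 * pi) + ln (real n)"
      using elim by (intro ln_mult_pos) auto
    moreover have "2 * pi / (3 * sqrt 3) * (u + v) = 2 * pi / sqrt 3 * (u / 3 + v / 3)" for u v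
      by (simp add: field_simps)
    ultimately have "2 * pi / (3 * sqrt 3) * ln (2 * pi * real n) =
                     2 * pi / sqrt 3 * (ln (2 * pi) / 3 + ln (real n) / 3)"
      by metis
    thus ?case
      by (simp only: logint_2pi_nat P_def right_diff_distrib distrib_left)
  qed
  ultimately have "(\<lambda>n. logint 0 + 2 * pi / sqrt 3 * (P n - ln (2 * pi) / 3)) \<longlonglongrightarrow> 0"
    by (rule Lim_transform_eventually)
  moreover have "(\<lambda>n. logint 0 + 2 * pi / sqrt 3 * (P n - ln (2 * pi) / 3)) \<longlonglongrightarrow>
                   logint 0 + 2 * pi / sqrt 3 * (ln (Gamma (1 / 3) / Gamma (2 / 3)) - ln (2 * pi) / 3)"
    by (intro tendsto_intros P)
  ultimately have "logint 0 + 2 * pi / sqrt 3 * (ln (Gamma (1 / 3) / Gamma (2 / 3)) - ln (2 * pi) / 3) = 0"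
    using LIMSEQ_unique by blast
  hence "logint 0 = 2 * pi / sqrt 3 * (ln (2 * pi) / 3 - ln (Gamma (1 / 3) / Gamma (2 / 3)))"
    unfolding right_diff_distrib by linarith
  moreover have pos: "Gamma (1 / 3 :: real) > 0" "Gamma (2 / 3 :: real) > 0"
    by (auto intro: Gamma_real_pos)
  have "ln (Gamma (1 / 3) / Gamma (2 / 3)) = ln (Gamma (1 / 3)) - ln (Gamma (2 / 3) :: real)"
    using pos by (intro ln_divide_pos)
  moreover have "ln (root 3 (2 * pi) * Gamma (2 / 3) / Gamma (1 / 3)) =
                   ln (2 * pi) / 3 + ln (Gamma (2 / 3)) - ln (Gamma (1 / 3) :: real)"
  proof -
    have "ln (root 3 (2 * pi) * Gamma (2 / 3) / Gamma (1 / 3)) =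
            ln (root 3 (2 * pi) * Gamma (2 / 3)) - ln (Gamma (1 / 3))"
      using pos by (intro ln_divide_pos) auto
    also have "ln (root 3 (2 * pi) * Gamma (2 / 3)) = ln (root 3 (2 * pi)) + ln (Gamma (2 / 3))"
      using pos by (intro ln_mult_pos) auto
    also have "ln (root 3 (2 * pi)) = ln (2 * pi) / 3"
      by (subst ln_root) auto
    finally show ?thesis .
  qed
  ultimately show ?thesis
    by (simp only: diff_diff_eq2)
qed

section \<open>Transfer to the unit interval\<close>

theorem corollary3p3:
  "((\<lambda>x::real. ln (- ln x) * (1 / (1 + x + x\<^sup>2))) has_integral
     (pi / sqrt 3 * ln (root 3 (2 * pi) * Gamma (2 / 3) / Gamma (1 / 3)))) {0<..<1}"
proof -
  define g0 where "g0 = (\<lambda>t. ln (t\<^sup>2 + 0\<^sup>2) / 2 * kern t)"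
  have int0: "integrable lborel g0"
    unfolding g0_def by (rule integrable_log_kern) simp
  define I where "I = (LBINT t:{0<..}. g0 t)"
  have set_int: "set_integrable lborel A g0" if "A \<in> sets borel" for A
    using int0 that unfolding set_integrable_def by (intro integrable_mult_indicator) auto
  \<comment> \<open>\<open>g0\<close> is even, so reflection shows that both half-lines contribute
    equally.\<close>
  have "(LBINT t:{..<0}. g0 t) = (LBINT t. indicator {..<0} (-t) *\<^sub>R g0 (-t))"
    unfolding set_lebesgue_integral_def using lborel_integral_real_affine[of "-1" _ 0] by fastforce
  also have "\<dots> = I"
    unfolding I_def set_lebesgue_integral_def
    by (intro Bochner_Integration.integral_cong) (auto simp: indicator_def g0_def)
  finally have neg: "(LBINT t:{..<0}. g0 t) = I" .
  have "logint 0 = (LBINT t. g0 t)"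
    by (simp add: logint_def g0_def)
  \<comment> \<open>Removing the origin leaves the integrand unchanged everywhere, as
    \<open>g0 0 = 0\<close> by \<open>ln 0 = 0\<close>.\<close>
  also have "\<dots> = (LBINT t:{..<0} \<union> {0<..}. g0 t)"
    unfolding set_lebesgue_integral_def g0_def
    by (intro Bochner_Integration.integral_cong) (auto simp: indicator_def)
  also have "\<dots> = I + I"
    using neg by (subst set_integral_Un) (auto intro: set_int simp: I_def)
  finally have I: "I = logint 0 / 2"
    by simp
  have "integral {0<..} g0 = I"
    unfolding I_def by (rule set_borel_integral_eq_integral(2)[symmetric], rule set_int) auto
  have "set_integrable lebesgue {0<..} g0"
    using set_int[of "{0<..}"] unfolding set_integrable_def
    by (simp add: integrable_completion borel_measurable_integrable)
  let ?f = "\<lambda>x::real. ln (- ln x) * (1 / (1 + x + x\<^sup>2))"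
  have "(?f absolutely_integrable_on (\<lambda>t. exp (- t)) ` {0<..}) \<and> integral ((\<lambda>t. exp (- t)) ` {0<..}) ?f = I"
  proof (rule iffD1[OF has_absolute_integral_change_of_variables_1'[where g' = "\<lambda>t. - exp (- t)"]])
    show "((\<lambda>t. exp (- t)) has_field_derivative - exp (- t)) (at t within {0<..})" for t :: real
      by (auto intro!: derivative_eq_intros)
    \<comment> \<open>Pulling \<open>exp (- t)\<close> out of \<open>1 + x + x^2\<close> at
      \<open>x = exp (- t)\<close> cancels the Jacobian and leaves the kernel.\<close>
    have eq: "\<bar>- exp (- t)\<bar> * ?f (exp (- t)) = g0 t" if "t \<in> {0<..}" for t
    proof -
      have "exp t * exp (- t) = 1"
        by (simp flip: exp_add)
      hence "1 + exp (- t) + (exp (- t))\<^sup>2 = exp (- t) * (exp t + 1 + exp (- t))"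
        by (simp add: algebra_simps power2_eq_square)
      thus ?thesis
        using that by (simp add: g0_def kern_def ln_realpow)
    qed
    show "(\<lambda>t. \<bar>- exp (- t)\<bar> * ?f (exp (- t))) absolutely_integrable_on {0<..} \<and>
          integral {0<..} (\<lambda>t. \<bar>- exp (- t)\<bar> * ?f (exp (- t))) = I"
      using \<open>set_integrable lebesgue {0<..} g0\<close> \<open>integral {0<..} g0 = I\<close>
      by (simp only: eq cong: set_integrable_cong Henstock_Kurzweil_Integration.integral_cong)
  qed (auto simp: inj_on_def)
  moreover have "(\<lambda>t. exp (- t)) ` {0<..} = {0<..<1::real}"
  proof safe
    fix x :: real assume "x \<in> {0<..<1}"
    thus "x \<in> (\<lambda>t. exp (- t)) ` {0<..}"
      by (intro image_eqI[of _ _ "- ln x"]) auto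
  qed auto
  ultimately have "(?f has_integral I) {0<..<1}"
    by (auto simp: has_integral_iff dest: set_lebesgue_integral_eq_integral(1))
  thus ?thesis
    unfolding I logint_0 by simp
qed

end
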